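(* For every integer $n\geq 2$ there exists a constant $C>0$ depending only on $n$ such that the following holds. Let $D$ be an unbounded convex domain in $\mathbb{R}^n$ with non-empty boundary $\partial D$. Suppose that $u\in C(\overline{D})$ is an $\infty$-harmonic function in $D$ such that $u|_{\partial D}=0$ and $u$ admits a positive value in $D$ (no other restriction is imposed on the sign of $u$). Let $x_0\in\partial D$ and let \[ \kappa_0:=\sup_{r>0}\frac{|D\cap B(x_0,r)|}{|B(x_0,r)|}. \] Define, for $r>0$, \[ \mathcal{M}(r)=\sup_{x\in D\cap B(x_0,r)}u(x). \] Then \[ \liminf_{r\to\infty}\frac{\log\mathcal{M}(r)}{\log r}\geq \alpha>0, \] where the number $\alpha$ depends only on $n$ and $\kappa_0$ and has the expression \[ \alpha=-\log_4\left(1-e^{-C\kappa_0^{1/n}}\right). \] In particular, $\alpha\to\infty$ as $\kappa_0\to 0$.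
   Context: $B(x,r)$ denotes the open ball in $\mathbb{R}^n$ centered at $x$ with radius $r$, and $|E|$ denotes the Lebesgue measure of a set $E\subset\mathbb{R}^n$. $\log_4$ is the logarithm to base $4$. The infinity Laplacian of a $C^2$ function $\varphi$ is \[ \Delta_\infty\varphi=\sum_{i,j=1}^n\frac{\partial\varphi}{\partial x_i}\frac{\partial\varphi}{\partial x_j}\frac{\partial^2\varphi}{\partial x_i\partial x_j}. \] The equation $\Delta_\infty u=0$ is interpreted in the viscosity sense. An upper semicontinuous function $u$ is $\infty$-subharmonic in $D$ if, for every $x_0\in D$ and every $\varphi\in C^2(D)$ such that $u-\varphi$ has a local maximum at $x_0$, we have $\Delta_\infty\varphi(x_0)\geq 0$. A lower semicontinuous function $u$ is $\infty$-superharmonic in $D$ if $-u$ is $\infty$-subharmonic in $D$. A function $u\in C(D)$ is $\infty$-harmonic in $D$ if it is both $\infty$-subharmonic and $\infty$-superharmonic in $D$. *)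

theory Defs
  imports "HOL-Analysis.Analysis"
begin

definition partial_deriv :: "'n::finite \<Rightarrow> (real ^ 'n \<Rightarrow> real) \<Rightarrow> real ^ 'n \<Rightarrow> real" where
  "partial_deriv i f x = frechet_derivative f (at x) (axis i 1)"

(* The class C^2(D); meant for open D, so that derivatives "at x" only see values of f in D. *)
definition C2_on :: "(real ^ 'n::finite) set \<Rightarrow> (real ^ 'n \<Rightarrow> real) \<Rightarrow> bool" where
  "C2_on D f \<longleftrightarrow>
     (\<forall>x\<in>D. f differentiable (at x)) \<and>
     (\<forall>i. \<forall>x\<in>D. partial_deriv i f differentiable (at x)) \<and>
     (\<forall>i j. continuous_on D (partial_deriv i (partial_deriv j f)))"

definition infinity_Laplacian :: "(real ^ 'n::finite \<Rightarrow> real) \<Rightarrow> real ^ 'n \<Rightarrow> real" where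
  "infinity_Laplacian f x =
     (\<Sum>i\<in>UNIV. \<Sum>j\<in>UNIV.
        partial_deriv i f x * partial_deriv j f x * partial_deriv i (partial_deriv j f) x)"

definition upper_semicontinuous_on :: "'a::topological_space set \<Rightarrow> ('a \<Rightarrow> real) \<Rightarrow> bool" where
  "upper_semicontinuous_on D u \<longleftrightarrow>
     (\<forall>x\<in>D. \<forall>a>u x. \<forall>\<^sub>F y in at x within D. u y < a)"

definition local_max_at :: "'a::topological_space set \<Rightarrow> ('a \<Rightarrow> real) \<Rightarrow> 'a \<Rightarrow> bool" where
  "local_max_at D f x \<longleftrightarrow> (\<forall>\<^sub>F y in at x within D. f y \<le> f x)"

definition infinity_subharmonic_on :: "(real ^ 'n::finite) set \<Rightarrow> (real ^ 'n \<Rightarrow> real) \<Rightarrow> bool" where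
  "infinity_subharmonic_on D u \<longleftrightarrow>
     upper_semicontinuous_on D u \<and>
     (\<forall>x0\<in>D. \<forall>\<phi>. C2_on D \<phi> \<and> local_max_at D (\<lambda>x. u x - \<phi> x) x0 \<longrightarrow>
        infinity_Laplacian \<phi> x0 \<ge> 0)"

(* Lower semicontinuity of u is upper semicontinuity of -u. *)
definition infinity_superharmonic_on :: "(real ^ 'n::finite) set \<Rightarrow> (real ^ 'n \<Rightarrow> real) \<Rightarrow> bool" where
  "infinity_superharmonic_on D u \<longleftrightarrow> infinity_subharmonic_on D (\<lambda>x. - u x)"

definition infinity_harmonic_on :: "(real ^ 'n::finite) set \<Rightarrow> (real ^ 'n \<Rightarrow> real) \<Rightarrow> bool" where
  "infinity_harmonic_on D u \<longleftrightarrow>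
     continuous_on D u \<and> infinity_subharmonic_on D u \<and> infinity_superharmonic_on D u"

(* The quotients lie in [0,1], so the real supremum is the intended one. *)
definition max_density :: "(real ^ 'n::finite) set \<Rightarrow> real ^ 'n \<Rightarrow> real" where
  "max_density D x0 =
     (SUP r\<in>{0<..}. measure lebesgue (D \<inter> ball x0 r) / measure lebesgue (ball x0 r))"

(* A real supremum: finite and nonempty whenever x0 is a boundary point of D and
   u is continuous on closure D, since u is then bounded on D \<inter> ball x0 r. *)
definition max_modulus ::
    "(real ^ 'n::finite) set \<Rightarrow> (real ^ 'n \<Rightarrow> real) \<Rightarrow> real ^ 'n \<Rightarrow> real \<Rightarrow> real" where
  "max_modulus D u x0 r = (SUP x\<in>D \<inter> ball x0 r. u x)"

definition growth_exponent :: "nat \<Rightarrow> real \<Rightarrow> real \<Rightarrow> real" where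
  "growth_exponent n C \<kappa> = - log 4 (1 - exp (- C * \<kappa> powr (1 / real n)))"

end

theory Submission
  imports Defs
begin

text \<open>
  The growth comes from one inequality between consecutive scales,
  \<open>M(r) \<le> q M(4r)\<close> with \<open>q = 1 - exp (-8 \<kappa>\<^sub>0 powr (1/n)) < 1\<close> and \<open>M\<close> the maximum modulus
  (\<open>max_modulus_quadruple\<close>). Iterating it along \<open>4 ^ k * r0\<close> turns the factor \<open>1/q\<close> per
  quadrupling into the power \<open>r powr \<alpha>\<close> with \<open>4 powr \<alpha> = 1/q\<close>
  (\<open>Liminf_growth_exponent\<close>), which is the asserted exponent for \<open>C = 8\<close>.

  The one-step inequality rests on two observations. First, let \<open>y\<close> lie outside \<open>D\<close> and suppose
  \<open>u \<le> M\<close> at the points of \<open>D\<close> at distance \<open>R\<close> from \<open>y\<close>. A cone with vertex \<open>y\<close> is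
  \<open>\<infinity>\<close>-harmonic away from \<open>y\<close>, and bending it slightly makes it a strict supersolution:
  \<open>\<phi>(z) = g(|z - y|)\<close> has \<open>\<Delta>\<^sub>\<infinity> \<phi> = g'\<^sup>2 g''\<close>, which is negative if \<open>g\<close> is increasing and strictly
  concave. The choice \<open>g(t) = M (1 - (1 - t/R)\<^sup>2)\<close> vanishes at the vertex and equals \<open>M\<close> at
  distance \<open>R\<close>, so \<open>\<phi>\<close> dominates \<open>u\<close> on the boundary of \<open>D \<inter> ball y R\<close>. As \<open>\<phi>\<close> is smooth on
  \<open>D\<close>, it may serve as a test function there, and the definition of a viscosity subsolution forbids
  a positive interior maximum of \<open>u - \<phi>\<close> (\<open>infinity_subharmonic_le_barrier\<close>). Hence \<open>u\<close> is small
  near the complement of \<open>D\<close>, linearly in the distance.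

  Second, a small volume density forces every point of \<open>D \<inter> ball x0 r\<close> to be close to the
  complement of \<open>D\<close>: a ball inside \<open>D \<inter> ball x0 (2r)\<close> cannot have radius above
  \<open>2 r \<kappa>\<^sub>0 powr (1/n)\<close> (\<open>exterior_point_near\<close>). When \<open>\<kappa>\<^sub>0\<close> is not small, the boundary point
  \<open>x0\<close> itself, at distance less than \<open>r\<close>, serves as the vertex.
\<close>

section \<open>The infinity Laplacian of radial functions\<close>

lemma partial_deriv_eq:
  assumes "(f has_derivative f') (at x)"
  shows "partial_deriv i f x = f' (axis i 1)"
  using frechet_derivative_at[OF assms] by (simp add: partial_deriv_def)

text \<open>
  Writing a radial function through the squared distance \<open>q\<close> makes the inner function a polynomial.
  With \<open>g(t) = h(t\<^sup>2)\<close> one has \<open>g' = 2 t h'\<close> and \<open>g'' = 2 (2 h'' q + h')\<close>, so the value below is the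
  product \<open>g'\<^sup>2 g''\<close>.
\<close>

lemma
  fixes y :: "real ^ 'n::finite" and h h' h'' :: "real \<Rightarrow> real"
  defines "\<phi> \<equiv> \<lambda>z. h ((z - y) \<bullet> (z - y))"
  assumes h': "\<And>q. q > 0 \<Longrightarrow> (h has_real_derivative h' q) (at q)"
    and h'': "\<And>q. q > 0 \<Longrightarrow> (h' has_real_derivative h'' q) (at q)"
    and cont: "continuous_on {0<..} h''"
  shows C2_on_radial: "C2_on (- {y}) \<phi>"
    and infinity_Laplacian_radial:
      "z \<noteq> y \<Longrightarrow> q = (z - y) \<bullet> (z - y) \<Longrightarrow>
         infinity_Laplacian \<phi> z = 8 * (h' q)\<^sup>2 * q * (2 * h'' q * q + h' q)"
proof -
  let ?q = "\<lambda>z. (z - y) \<bullet> (z - y)"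
  have q_pos: "?q z > 0" if "z \<noteq> y" for z
    using that by simp
  have dq: "(?q has_derivative (\<lambda>v. 2 * ((z - y) \<bullet> v))) (at z)" for z
    by (auto intro!: derivative_eq_intros simp: inner_commute)
  have d1: "(\<phi> has_derivative (\<lambda>v. h' (?q z) * (2 * ((z - y) \<bullet> v)))) (at z)"
    if "z \<noteq> y" for z
    using has_derivative_compose[OF dq, of h "\<lambda>v. h' (?q z) * v" z] h'[OF q_pos[OF that]]
    by (simp add: \<phi>_def has_field_derivative_def)
  have p1: "partial_deriv j \<phi> z = 2 * h' (?q z) * (z - y) $ j" if "z \<noteq> y" for j z
    by (simp add: partial_deriv_eq[OF d1[OF that]] inner_axis)
  \<comment> \<open>The derivative of the \<open>j\<close>-th partial derivative at \<open>z\<close> in direction \<open>v\<close>.\<close>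
  define \<psi> where "\<psi> = (\<lambda>j v z. 4 * h'' (?q z) * ((z - y) \<bullet> v) * (z - y) $ j + 2 * h' (?q z) * v $ j)"
  have d2': "((\<lambda>z. 2 * h' (?q z) * (z - y) $ j) has_derivative (\<lambda>v. \<psi> j v z)) (at z)"
    if "z \<noteq> y" for j z
  proof -
    have a: "((\<lambda>z. h' (?q z)) has_derivative (\<lambda>v. h'' (?q z) * (2 * ((z - y) \<bullet> v)))) (at z)"
      using has_derivative_compose[OF dq, of h' "\<lambda>v. h'' (?q z) * v" z] h''[OF q_pos[OF that]]
      by (simp add: has_field_derivative_def)
    have b: "((\<lambda>z. (z - y) $ j) has_derivative (\<lambda>v. v $ j)) (at z)"
      by (rule bounded_linear.has_derivative[OF bounded_linear_vec_nth])
        (auto intro!: derivative_eq_intros)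
    show ?thesis
      using has_derivative_mult[OF has_derivative_mult_right[OF a, of 2] b]
      by (rule has_derivative_eq_rhs) (simp add: \<psi>_def fun_eq_iff algebra_simps)
  qed
  have d2: "(partial_deriv j \<phi> has_derivative (\<lambda>v. \<psi> j v z)) (at z)" if "z \<noteq> y" for j z
    by (rule has_derivative_transform_within_open[OF d2'[OF that], where s = "- {y}"])
      (use that in \<open>auto simp: p1\<close>)
  have p2: "partial_deriv i (partial_deriv j \<phi>) z = \<psi> j (axis i 1) z" if "z \<noteq> y" for i j z
    by (rule partial_deriv_eq[OF d2[OF that]])
  have cont_\<psi>: "continuous_on (- {y}) (\<lambda>z. \<psi> j v z)" for j v
  proof -
    have "continuous_on {0<..} h'"
      using h'' by (intro continuous_at_imp_continuous_on) (auto intro: DERIV_isCont)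
    moreover have "continuous_on (- {y}) ?q" "?q ` (- {y}) \<subseteq> {0<..}"
      by (intro continuous_intros) (use q_pos in auto)
    ultimately have "continuous_on (- {y}) (\<lambda>z. h' (?q z))" "continuous_on (- {y}) (\<lambda>z. h'' (?q z))"
      using continuous_on_compose2 cont by blast+
    then show ?thesis
      unfolding \<psi>_def by (intro continuous_intros)
  qed
  have "continuous_on (- {y}) (partial_deriv i (partial_deriv j \<phi>))" for i j
    by (rule continuous_on_eq[OF cont_\<psi>]) (simp add: p2)
  then show "C2_on (- {y}) \<phi>"
    unfolding C2_on_def differentiable_def using d1 d2 by blast
  show "infinity_Laplacian \<phi> z = 8 * (h' q)\<^sup>2 * q * (2 * h'' q * q + h' q)"
    if z: "z \<noteq> y" and q: "q = ?q z"
  proof -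
    define w where "w = (\<lambda>i. (z - y) $ i)"
    have q': "q = (\<Sum>i\<in>UNIV. (w i)\<^sup>2)"
      by (simp add: q w_def inner_vec_def power2_eq_square)
    have first: "partial_deriv i \<phi> z = 2 * h' q * w i" for i
      by (simp only: p1[OF z] w_def q)
    have second: "partial_deriv i (partial_deriv j \<phi>) z
        = 4 * h'' q * w i * w j + (if j = i then 2 * h' q else 0)" for i j
      unfolding p2[OF z] \<psi>_def q[symmetric] w_def inner_axis by (simp add: axis_def)
    have "infinity_Laplacian \<phi> z =
      (\<Sum>i\<in>UNIV. \<Sum>j\<in>UNIV. 16 * (h' q)\<^sup>2 * h'' q * ((w i)\<^sup>2 * (w j)\<^sup>2)
         + (if j = i then 8 * (h' q) ^ 3 * (w i)\<^sup>2 else 0))"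
      unfolding infinity_Laplacian_def first second
      by (intro sum.cong refl) (auto simp: power2_eq_square power3_eq_cube algebra_simps)
    also have "\<dots> = 16 * (h' q)\<^sup>2 * h'' q * (\<Sum>i\<in>UNIV. \<Sum>j\<in>UNIV. (w i)\<^sup>2 * (w j)\<^sup>2)
        + 8 * (h' q) ^ 3 * (\<Sum>i\<in>UNIV. (w i)\<^sup>2)"
      by (simp add: sum.distrib sum_distrib_left)
    also have "\<dots> = 16 * (h' q)\<^sup>2 * h'' q * (q * q) + 8 * (h' q) ^ 3 * q"
      unfolding q' sum_product ..
    finally show ?thesis
      by (simp add: power2_eq_square power3_eq_cube algebra_simps)
  qed
qed

lemma C2_on_subset: "C2_on S f \<Longrightarrow> T \<subseteq> S \<Longrightarrow> C2_on T f"
  unfolding C2_on_def by (meson continuous_on_subset subsetD)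

section \<open>Comparison with a bent cone\<close>

text \<open>
  The barrier increases with the distance up to \<open>R\<close> and is strictly concave in it, hence a strict
  supersolution off its vertex. At a point where \<open>u\<close> exceeds it the most, it touches a translate of
  \<open>u\<close> from above. That point is neither on the frontier of \<open>D\<close>, where \<open>u \<le> 0\<close>, nor at distance
  \<open>R\<close>, where the barrier equals \<open>M\<close>; inside, the subsolution property is violated. The vertex may
  lie on the frontier, since smoothness is needed on the open set \<open>D\<close> only.
\<close>

lemma infinity_subharmonic_le_barrier:
  fixes D :: "(real ^ 'n::finite) set"
  assumes D: "open D" and u: "continuous_on (closure D) u" "infinity_subharmonic_on D u"
    and bdry: "\<And>z. z \<in> frontier D \<Longrightarrow> u z \<le> 0"
    and y: "y \<notin> D" and R: "R > 0" and M: "M > 0"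
    and le_M: "\<And>z. z \<in> D \<Longrightarrow> dist z y = R \<Longrightarrow> u z \<le> M"
    and x: "x \<in> D" "dist x y \<le> R"
  shows "u x \<le> M * (1 - (1 - dist x y / R)\<^sup>2)"
proof (rule ccontr)
  assume contra: "\<not> u x \<le> M * (1 - (1 - dist x y / R)\<^sup>2)"
  define h where "h = (\<lambda>q. M * (1 - (1 - sqrt q / R)\<^sup>2))"
  define h' where "h' = (\<lambda>q. M / R * (1 / sqrt q - 1 / R))"
  define h'' where "h'' = (\<lambda>q. - M / (2 * R * (q * sqrt q)))"
  define \<phi> where "\<phi> = (\<lambda>z. h ((z - y) \<bullet> (z - y)))"
  have \<phi>: "\<phi> z = M * (1 - (1 - dist z y / R)\<^sup>2)" for z
    by (simp add: \<phi>_def h_def dist_norm norm_eq_sqrt_inner)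
  have h': "(h has_real_derivative h' q) (at q)" if "q > 0" for q
    unfolding h_def h'_def
    by (rule DERIV_cong[of _ "- (M * (2 * (1 - sqrt q / R) * - (inverse (sqrt q) / 2 / R)))"])
      (use that R in \<open>auto intro!: derivative_eq_intros simp: divide_simps eval_nat_numeral\<close>)
  have h'': "(h' has_real_derivative h'' q) (at q)" if "q > 0" for q
    unfolding h'_def h''_def using that R
    by (auto intro!: derivative_eq_intros simp: field_simps)
  have "continuous_on {0<..} h''"
    unfolding h''_def using R by (intro continuous_intros) auto
  note radial = C2_on_radial[OF h' h'' this] infinity_Laplacian_radial[OF h' h'' this]
  have C2: "C2_on D \<phi>"
    unfolding \<phi>_def by (rule C2_on_subset[OF radial(1)]) (use y in auto)
  let ?K = "closure D \<inter> cball y R"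
  have "compact ?K"
    by (simp add: closed_Int_compact)
  moreover have xK: "x \<in> ?K"
    using x closure_subset by (auto simp: dist_commute)
  moreover have "continuous_on ?K (\<lambda>z. u z - \<phi> z)"
    unfolding \<phi> by (intro continuous_intros continuous_on_subset[OF u(1)]) (use R in auto)
  ultimately obtain p where p: "p \<in> ?K" "\<And>z. z \<in> ?K \<Longrightarrow> u z - \<phi> z \<le> u p - \<phi> p"
    using continuous_attains_sup[of ?K "\<lambda>z. u z - \<phi> z"] by blast
  have pos: "u p > \<phi> p"
    using p(2)[OF xK] contra by (simp add: \<phi>)
  have pR: "dist p y \<le> R"
    using p(1) by (simp add: dist_commute)
  have "\<phi> p \<ge> 0"
    using pR R M unfolding \<phi>
    by (auto intro!: mult_nonneg_nonneg power_le_one simp: divide_le_eq)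
  then have pD: "p \<in> D"
    using pos bdry[of p] p(1) D by (auto simp: frontier_def interior_open)
  have pR': "dist p y < R"
    using pR pos le_M[OF pD] R by (cases "dist p y = R") (auto simp: \<phi>)
  define q where "q = (p - y) \<bullet> (p - y)"
  have py: "p \<noteq> y"
    using pD y by auto
  have sq: "sqrt q = dist p y" and q: "q > 0"
    using py by (auto simp: q_def dist_norm norm_eq_sqrt_inner)
  \<comment> \<open>The cone part \<open>2 * M * sqrt q / R\<close> of \<open>h\<close> cancels here; only the bending \<open>- M * q / R\<^sup>2\<close>
    contributes.\<close>
  have "2 * h'' q * q + h' q = - M / R\<^sup>2"
    using q R unfolding h'_def h''_def by (simp add: field_simps power2_eq_square)
  moreover have "h' q > 0"
    unfolding h'_def sq using R M pR' py by (auto simp: divide_simps)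
  moreover have "infinity_Laplacian \<phi> p = 8 * (h' q)\<^sup>2 * q * (2 * h'' q * q + h' q)"
    unfolding \<phi>_def by (rule radial(2)[OF _ _ py q_def])
  ultimately have "infinity_Laplacian \<phi> p < 0"
    using q M R by (auto intro!: mult_pos_neg)
  moreover have "local_max_at D (\<lambda>z. u z - \<phi> z) p"
    unfolding local_max_at_def eventually_at
  proof (intro exI[of _ "R - dist p y"] conjI ballI impI)
    fix z assume "z \<in> D" "z \<noteq> p \<and> dist z p < R - dist p y"
    then have "z \<in> ?K"
      using closure_subset dist_triangle[of z y p] by (auto simp: dist_commute)
    then show "u z - \<phi> z \<le> u p - \<phi> p" by (rule p(2))
  qed (use pR' in auto)
  ultimately show False
    using u(2) pD C2 unfolding infinity_subharmonic_on_def by fastforce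
qed

section \<open>Volume density and distance to the complement\<close>

lemma measure_le_max_density:
  fixes D :: "(real ^ 'n::finite) set"
  assumes D: "open D" and r: "r > 0"
  shows "measure lebesgue (D \<inter> ball x0 r) \<le> max_density D x0 * measure lebesgue (ball x0 r)"
    and "D \<inter> ball x0 r \<noteq> {} \<Longrightarrow> max_density D x0 > 0"
proof -
  let ?f = "\<lambda>r. measure lebesgue (D \<inter> ball x0 r) / measure lebesgue (ball x0 r)"
  have "measure lebesgue (D \<inter> ball x0 t) \<le> measure lebesgue (ball x0 t)" for t
    using D by (intro measure_mono_fmeasurable) auto
  then have "?f t \<le> 1" for t
    by (simp add: divide_le_eq_1 less_le)
  then have "bdd_above (?f ` {0<..})"
    by (intro bdd_aboveI2)
  then have le: "?f r \<le> max_density D x0"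
    unfolding max_density_def using r by (intro cSUP_upper) auto
  have pos: "measure lebesgue (ball x0 r) > 0"
    using r by (simp add: measure_completion content_ball_pos)
  show "measure lebesgue (D \<inter> ball x0 r) \<le> max_density D x0 * measure lebesgue (ball x0 r)"
    using le pos by (simp add: divide_le_eq)
  assume "D \<inter> ball x0 r \<noteq> {}"
  moreover have "open (D \<inter> ball x0 r)"
    using D by auto
  ultimately have "\<not> negligible (D \<inter> ball x0 r)"
    by (rule open_not_negligible[rotated])
  moreover have "D \<inter> ball x0 r \<in> lmeasurable"
    using D by (intro bounded_set_imp_lmeasurable) auto
  ultimately have "measure lebesgue (D \<inter> ball x0 r) > 0"
    using negligible_iff_measure by (metis zero_less_measure_iff)
  then show "max_density D x0 > 0"
    using le pos by (meson divide_pos_pos less_le_trans)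
qed

text \<open>
  A ball of radius \<open>\<rho>\<close> about \<open>x\<close> inside \<open>D\<close> also lies in \<open>ball x0 (2 * r)\<close>, so its
  volume is at most the fraction \<open>max_density D x0\<close> of the volume of the latter; this bounds \<open>\<rho>\<close>.
\<close>

lemma exterior_point_near:
  fixes D :: "(real ^ 'n::finite) set"
  assumes D: "open D" and x: "dist x x0 < r" and \<rho>: "\<rho> \<le> r"
    and big: "\<rho> > 2 * r * max_density D x0 powr (1 / CARD('n))" and \<kappa>: "max_density D x0 > 0"
  shows "\<exists>y. y \<notin> D \<and> dist x y < \<rho>"
proof (rule ccontr)
  assume "\<not> ?thesis"
  then have "ball x \<rho> \<subseteq> D"
    by auto
  moreover have "ball x \<rho> \<subseteq> ball x0 (2 * r)"
    using x \<rho> by (intro ball_subset_ball_iff[THEN iffD2] disjI1) (simp add: dist_commute)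
  ultimately have sub: "ball x \<rho> \<subseteq> D \<inter> ball x0 (2 * r)"
    by simp
  have r: "r > 0" using x by (smt (verit) zero_le_dist)
  let ?V = "unit_ball_vol CARD('n)" and ?s = "max_density D x0 powr (1 / CARD('n))"
  have \<rho>0: "\<rho> > 0" using big r by (smt (verit) mult_nonneg_nonneg powr_ge_zero)
  have "measure lebesgue (ball x \<rho>) \<le> measure lebesgue (D \<inter> ball x0 (2 * r))"
    using D sub
    by (intro measure_mono_fmeasurable bounded_set_imp_lmeasurable) auto
  also have "\<dots> \<le> max_density D x0 * measure lebesgue (ball x0 (2 * r))"
    using measure_le_max_density(1)[OF D, of "2 * r" x0] r by simp
  finally have "?V * \<rho> ^ CARD('n) \<le> max_density D x0 * (?V * (2 * r) ^ CARD('n))"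
    using \<rho>0 r by (simp add: measure_completion content_ball)
  then have "\<rho> ^ CARD('n) \<le> max_density D x0 * (2 * r) ^ CARD('n)"
    by (simp add: mult.left_commute)
  also have "max_density D x0 = ?s ^ CARD('n)"
    using \<kappa> by (simp add: powr_realpow[symmetric] powr_powr)
  also have "?s ^ CARD('n) * (2 * r) ^ CARD('n) = (2 * r * ?s) ^ CARD('n)"
    by (simp add: power_mult_distrib mult.commute)
  finally show False
    using big \<rho>0 power_less_imp_less_base power_strict_mono[OF big, of "CARD('n)"] r by simp
qed

section \<open>Decay of the maximum modulus from one scale to the next\<close>

lemma frontier_ball_meets:
  "x0 \<in> frontier D \<Longrightarrow> r > 0 \<Longrightarrow> D \<inter> ball x0 r \<noteq> {}"
  by (force simp: frontier_def closure_approachable dist_commute)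

lemma bdd_above_image_ball:
  fixes D :: "(real ^ 'n::finite) set"
    and u :: "real ^ 'n \<Rightarrow> real"
  assumes "continuous_on (closure D) u"
  shows "bdd_above (u ` (D \<inter> ball x0 r))"
proof -
  have "bounded (u ` (closure D \<inter> cball x0 r))"
    by (intro compact_imp_bounded compact_continuous_image continuous_on_subset[OF assms])
      (auto simp: closed_Int_compact)
  then have "bdd_above (u ` (closure D \<inter> cball x0 r))"
    by (rule bounded_imp_bdd_above)
  then show ?thesis
    by (rule bdd_above_mono) (use closure_subset[of D] in auto)
qed

text \<open>
  The left-hand sides are the values of the barrier profile \<open>1 - (1 - \<tau>)\<^sup>2\<close> at \<open>\<tau> = 1/2\<close> and
  \<open>\<tau> = 2 s\<close>. The exponent 8 is large enough because \<open>exp (4 s) \<ge> 1 + 4 s\<close>, which is at least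
  \<open>2\<close> in the first case and at least \<open>1 / (1 - 2 s)\<close> in the second.
\<close>

lemma one_step_factor:
  fixes s :: real
  shows "s \<ge> 1 / 4 \<Longrightarrow> 3 / 4 \<le> 1 - exp (- 8 * s)"
    and "0 < s \<Longrightarrow> s < 1 / 4 \<Longrightarrow> 1 - (1 - 2 * s)\<^sup>2 \<le> 1 - exp (- 8 * s)"
proof -
  have e: "exp (- 8 * s) = (1 / exp (4 * s))\<^sup>2"
    by (simp add: power_divide exp_minus exp_double[symmetric] divide_simps flip: exp_add)
  have g: "exp (4 * s) \<ge> 1 + 4 * s"
    by (rule exp_ge_add_one_self)
  { assume "s \<ge> 1 / 4"
    then have "exp (4 * s) \<ge> 2"
      using g by linarith
    then have "1 / exp (4 * s) \<le> 1 / 2"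
      by (intro divide_left_mono) auto
    then have "(1 / exp (4 * s))\<^sup>2 \<le> (1 / 2)\<^sup>2"
      by (intro power_mono) auto
    then show "3 / 4 \<le> 1 - exp (- 8 * s)"
      unfolding e by (simp add: power2_eq_square) }
  { assume s: "0 < s" "s < 1 / 4"
    have "1 \<le> (1 - 2 * s) * (1 + 4 * s)"
      using mult_nonneg_nonneg[of s "1 - 4 * s"] s by (simp add: algebra_simps)
    also have "\<dots> \<le> (1 - 2 * s) * exp (4 * s)"
      using g s by (intro mult_left_mono) auto
    finally have "1 / exp (4 * s) \<le> 1 - 2 * s"
      by (simp add: divide_le_eq)
    then have "(1 / exp (4 * s))\<^sup>2 \<le> (1 - 2 * s)\<^sup>2"
      by (intro power_mono) auto
    then show "1 - (1 - 2 * s)\<^sup>2 \<le> 1 - exp (- 8 * s)"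
      unfolding e by simp }
qed

text \<open>
  The barrier is used with \<open>R = 2 r\<close> and a vertex in \<open>ball x0 (2 * r)\<close>, so that points at distance
  \<open>R\<close> from the vertex stay in \<open>ball x0 (4 * r)\<close>; this is where the factor 4 comes from. The vertex
  is within \<open>4 r s\<close> of the point in question if \<open>s < 1/4\<close>, and is \<open>x0\<close> otherwise. The radius
  \<open>4 r s\<close> is twice the critical radius \<open>2 r s\<close> of \<open>exterior_point_near\<close>, which avoids a limit.
\<close>

lemma max_modulus_quadruple:
  fixes D :: "(real ^ 'n::finite) set"
  assumes D: "open D" and u: "continuous_on (closure D) u" "infinity_subharmonic_on D u"
    and bdry: "\<And>z. z \<in> frontier D \<Longrightarrow> u z \<le> 0" and x0: "x0 \<in> frontier D"
    and r: "r > 0" and M: "max_modulus D u x0 (4 * r) > 0"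
  shows "max_modulus D u x0 r
    \<le> (1 - exp (- 8 * max_density D x0 powr (1 / CARD('n)))) * max_modulus D u x0 (4 * r)"
proof -
  define s where "s = max_density D x0 powr (1 / CARD('n))"
  let ?M = "max_modulus D u x0 (4 * r)"
  have x0D: "x0 \<notin> D" using x0 D by (simp add: frontier_def interior_open)
  have ne: "D \<inter> ball x0 r \<noteq> {}"
    by (rule frontier_ball_meets[OF x0 r])
  have \<kappa>: "max_density D x0 > 0"
    using measure_le_max_density(2)[OF D r ne] .
  then have s: "s > 0" by (simp add: s_def)
  have barrier: "u x \<le> ?M * (1 - (1 - \<tau>)\<^sup>2)"
    if x: "x \<in> D" and y: "y \<notin> D" "dist y x0 < 2 * r"
      and \<tau>: "dist x y \<le> \<tau> * (2 * r)" "\<tau> \<le> 1" for x y \<tau>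
  proof -
    have le_M: "u z \<le> ?M" if "z \<in> D" "dist z y = 2 * r" for z
    proof -
      have "z \<in> D \<inter> ball x0 (4 * r)"
        using that y dist_triangle[of z x0 y] by (auto simp: dist_commute)
      then show ?thesis
        unfolding max_modulus_def by (intro cSUP_upper bdd_above_image_ball u(1))
    qed
    have "\<tau> * (2 * r) \<le> 1 * (2 * r)"
      using \<tau>(2) r by (intro mult_right_mono) auto
    with \<tau>(1) have "dist x y \<le> 2 * r"
      by linarith
    then have "u x \<le> ?M * (1 - (1 - dist x y / (2 * r))\<^sup>2)"
      using infinity_subharmonic_le_barrier[OF D u bdry y(1) _ M, of "2 * r" x] le_M x r by simp
    also have "\<dots> \<le> ?M * (1 - (1 - \<tau>)\<^sup>2)"
      using M \<tau> r by (intro mult_left_mono diff_left_mono power_mono) (auto simp: divide_le_eq)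
    finally show ?thesis .
  qed
  have "u x \<le> (1 - exp (- 8 * s)) * ?M" if x: "x \<in> D" "dist x x0 < r" for x
  proof (cases "s \<ge> 1 / 4")
    case True
    have "u x \<le> ?M * (1 - (1 - 1 / 2)\<^sup>2)"
      by (rule barrier[OF x(1) x0D]) (use r x in auto)
    also have "\<dots> = 3 / 4 * ?M"
      by (simp add: power2_eq_square)
    also have "\<dots> \<le> (1 - exp (- 8 * s)) * ?M"
      using one_step_factor(1)[OF True] M by (intro mult_right_mono) auto
    finally show ?thesis .
  next
    case False
    then have "4 * r * s \<le> r" "4 * r * s > 2 * r * s"
      using r s by auto
    then obtain y where y: "y \<notin> D" "dist x y < 4 * r * s"
      using exterior_point_near[OF D x(2) _ _ \<kappa>] unfolding s_def by blast
    have "u x \<le> ?M * (1 - (1 - 2 * s)\<^sup>2)"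
    proof (rule barrier[OF x(1) y(1)])
      show "dist y x0 < 2 * r"
        using y(2) \<open>4 * r * s \<le> r\<close> x(2) dist_triangle[of y x0 x] by (simp add: dist_commute)
    qed (use y False in \<open>auto simp: mult_ac\<close>)
    also have "\<dots> \<le> ?M * (1 - exp (- 8 * s))"
      using one_step_factor(2)[OF s] False M by (intro mult_left_mono) auto
    finally show ?thesis by (simp add: mult.commute)
  qed
  then show ?thesis
    unfolding s_def max_modulus_def[of D u x0 r]
    using ne by (intro cSUP_least) (auto simp: dist_commute)
qed

section \<open>From the scale inequality to the growth exponent\<close>

text \<open>
  Iteration gives \<open>f (4 ^ k * r0) \<ge> f r0 / q ^ k\<close>. Monotonicity fills the gaps between the points
  \<open>4 ^ k * r0\<close> at the cost of a constant factor, which is invisible after dividing by \<open>ln r\<close>.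
\<close>

lemma Liminf_growth_exponent:
  fixes f :: "real \<Rightarrow> real"
  assumes mono: "\<And>a b. 0 < a \<Longrightarrow> a \<le> b \<Longrightarrow> f a \<le> f b"
    and r0: "r0 > 0" "f r0 > 0" and q: "0 < q" "q < 1"
    and step: "\<And>r. r \<ge> r0 \<Longrightarrow> f r \<le> q * f (4 * r)"
  shows "Liminf at_top (\<lambda>r. ereal (ln (f r) / ln r)) \<ge> ereal (- log 4 q)"
proof -
  define \<alpha> where "\<alpha> = - log 4 q"
  have \<alpha>: "\<alpha> \<ge> 0" "- ln q = \<alpha> * ln 4"
    using q by (auto simp: \<alpha>_def log_def divide_le_0_iff)
  have iter: "f r0 \<le> q ^ k * f (4 ^ k * r0)" for k
  proof (induction k)
    case (Suc k)
    have "r0 \<le> 4 ^ k * r0"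
      using r0 by (simp add: one_le_power)
    from step[OF this] have "q ^ k * f (4 ^ k * r0) \<le> q ^ k * (q * f (4 * (4 ^ k * r0)))"
      using q by (intro mult_left_mono) auto
    with Suc show ?case by (simp add: mult_ac)
  qed simp
  \<comment> \<open>The term \<open>ln 4\<close> pays for rounding \<open>log 4 (r / r0)\<close> down to an integer.\<close>
  define c where "c = ln (f r0) - \<alpha> * (ln r0 + ln 4)"
  have lower: "\<alpha> + c / ln r \<le> ln (f r) / ln r" if r: "r \<ge> r0" "r > 1" for r
  proof -
    define k where "k = nat \<lfloor>log 4 (r / r0)\<rfloor>"
    have l0: "log 4 (r / r0) \<ge> 0"
      using r r0 by simp
    then have k: "real k \<le> log 4 (r / r0)" "log 4 (r / r0) \<le> real k + 1"
      unfolding k_def by linarith+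
    have "4 ^ k = 4 powr real k"
      by (simp add: powr_realpow)
    also have "\<dots> \<le> r / r0"
      using k(1) r r0 by (simp add: le_log_iff)
    finally have "4 ^ k * r0 \<le> r"
      using r0 by (simp add: le_divide_eq)
    then have "f (4 ^ k * r0) \<le> f r"
      using r0 by (intro mono) auto
    then have "f r0 \<le> q ^ k * f r"
      using iter[of k] q by (meson mult_left_mono order_trans zero_le_power less_imp_le)
    moreover from this have fr: "f r > 0"
      using r0 q by (smt (verit) mult_nonneg_nonpos zero_le_power)
    ultimately have "ln (f r0) \<le> ln (q ^ k * f r)"
      using r0 by (simp add: q)
    also have "\<dots> = real k * ln q + ln (f r)"
      using q fr by (simp add: ln_mult ln_realpow)
    finally have "ln (f r) \<ge> ln (f r0) + real k * (\<alpha> * ln 4)"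
      unfolding \<alpha>(2)[symmetric] by simp
    moreover have "(ln r - ln r0) \<le> (real k + 1) * ln 4"
      using k(2) r r0 by (simp add: log_def ln_div divide_le_eq)
    then have "\<alpha> * (ln r - ln r0) \<le> \<alpha> * ((real k + 1) * ln 4)"
      using \<alpha>(1) by (rule mult_left_mono)
    ultimately have "\<alpha> * ln r + c \<le> ln (f r)"
      by (simp add: c_def algebra_simps)
    then have "(\<alpha> * ln r + c) / ln r \<le> ln (f r) / ln r"
      using r by (intro divide_right_mono) auto
    then show ?thesis
      using r by (simp add: add_divide_distrib)
  qed
  have "((\<lambda>r. \<alpha> + c / ln r) \<longlongrightarrow> \<alpha> + 0) at_top"
    by (intro tendsto_intros tendsto_divide_0[OF tendsto_const]
        filterlim_at_top_imp_at_infinity ln_at_top)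
  then have "((\<lambda>r. ereal (\<alpha> + c / ln r)) \<longlongrightarrow> ereal \<alpha>) at_top"
    by simp
  then have "ereal \<alpha> = Liminf at_top (\<lambda>r. ereal (\<alpha> + c / ln r))"
    by (intro lim_imp_Liminf[symmetric]) auto
  also have "\<dots> \<le> Liminf at_top (\<lambda>r. ereal (ln (f r) / ln r))"
    by (intro Liminf_mono eventually_mono[OF eventually_conj[OF
            eventually_ge_at_top[of r0] eventually_gt_at_top[of 1]]])
      (use lower in auto)
  finally show ?thesis by (simp add: \<alpha>_def)
qed

lemma filterlim_growth_exponent:
  assumes "n > 0" "C > 0"
  shows "filterlim (growth_exponent n C) at_top (at_right 0)"
proof -
  have "((\<lambda>\<kappa>::real. 1 - exp (- C * \<kappa> powr (1 / real n))) \<longlongrightarrow> 1 - exp (- C * 0 powr (1 / real n)))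
      (at_right 0)"
    using assms by (intro tendsto_intros tendsto_powr') (auto simp: eventually_at_filter)
  moreover have "\<forall>\<^sub>F \<kappa>::real in at_right 0. 1 - exp (- C * \<kappa> powr (1 / real n)) > 0"
    using assms by (intro eventually_mono[OF eventually_at_right_less]) auto
  ultimately have "filterlim (\<lambda>\<kappa>::real. 1 - exp (- C * \<kappa> powr (1 / real n))) (at_right 0) (at_right 0)"
    by (auto simp: filterlim_at elim: eventually_mono)
  from filterlim_compose[OF ln_at_0 this]
  have "filterlim (\<lambda>\<kappa>::real. ln (1 - exp (- C * \<kappa> powr (1 / real n)))) at_bot (at_right 0)" .
  then have "filterlim (\<lambda>\<kappa>::real. - ln (1 - exp (- C * \<kappa> powr (1 / real n)))) at_top (at_right 0)"
    by (simp add: filterlim_uminus_at_bot)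
  then have "filterlim (\<lambda>\<kappa>::real. (1 / ln 4) * - ln (1 - exp (- C * \<kappa> powr (1 / real n)))) at_top (at_right 0)"
    by (intro filterlim_tendsto_pos_mult_at_top[OF tendsto_const]) auto
  then show ?thesis
    unfolding growth_exponent_def[abs_def] log_def by simp
qed

theorem theorem2p4:
  assumes "CARD('n::finite) \<ge> 2"
  shows "\<exists>C>0.
    (\<forall>(D :: (real ^ 'n) set) u x0.
       open D \<and> D \<noteq> {} \<and> convex D \<and> \<not> bounded D \<and> frontier D \<noteq> {} \<and>
       continuous_on (closure D) u \<and> infinity_harmonic_on D u \<and>
       (\<forall>x\<in>frontier D. u x = 0) \<and> (\<exists>x\<in>D. u x > 0) \<and> x0 \<in> frontier D
       \<longrightarrow>
       Liminf at_top (\<lambda>r. ereal (ln (max_modulus D u x0 r) / ln r))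
         \<ge> ereal (growth_exponent CARD('n) C (max_density D x0)) \<and>
       growth_exponent CARD('n) C (max_density D x0) > 0) \<and>
    filterlim (growth_exponent CARD('n) C) at_top (at_right 0)"
proof (intro exI[of _ 8] conjI allI impI)
  fix D :: "(real ^ 'n) set" and u x0
  assume hyps: "open D \<and> D \<noteq> {} \<and> convex D \<and> \<not> bounded D \<and> frontier D \<noteq> {} \<and>
       continuous_on (closure D) u \<and> infinity_harmonic_on D u \<and>
       (\<forall>x\<in>frontier D. u x = 0) \<and> (\<exists>x\<in>D. u x > 0) \<and> x0 \<in> frontier D"
  then have D: "open D" and u: "continuous_on (closure D) u" "infinity_subharmonic_on D u"
    and bdry: "\<And>x. x \<in> frontier D \<Longrightarrow> u x \<le> 0" and x0: "x0 \<in> frontier D"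
    by (auto simp: infinity_harmonic_on_def)
  obtain x1 where x1: "x1 \<in> D" "u x1 > 0"
    using hyps by auto
  define r0 where "r0 = dist x0 x1 + 1"
  have r0: "r0 > 0" "x1 \<in> D \<inter> ball x0 r0"
    using x1 by (auto simp: r0_def intro: add_nonneg_pos)
  have ne: "D \<inter> ball x0 r \<noteq> {}" if "r > 0" for r
    by (rule frontier_ball_meets[OF x0 that])
  define q where "q = 1 - exp (- 8 * max_density D x0 powr (1 / real CARD('n)))"
  have "max_density D x0 > 0"
    using measure_le_max_density(2)[OF D r0(1) ne[OF r0(1)]] .
  then have q: "0 < q" "q < 1"
    by (auto simp: q_def)
  have exponent: "growth_exponent CARD('n) 8 (max_density D x0) = - log 4 q"
    by (simp add: growth_exponent_def q_def)
  show "growth_exponent CARD('n) 8 (max_density D x0) > 0"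
    using q by (simp add: exponent)
  let ?f = "max_modulus D u x0"
  have mono: "?f a \<le> ?f b" if "0 < a" "a \<le> b" for a b
    unfolding max_modulus_def using that ne
    by (intro cSUP_subset_mono bdd_above_image_ball u(1)) auto
  have "u x1 \<le> ?f r0"
    unfolding max_modulus_def by (intro cSUP_upper bdd_above_image_ball u(1) r0(2))
  then have pos: "?f r0 > 0" using x1 by simp
  show "Liminf at_top (\<lambda>r. ereal (ln (?f r) / ln r))
      \<ge> ereal (growth_exponent CARD('n) 8 (max_density D x0))"
    unfolding exponent
  proof (rule Liminf_growth_exponent[where f = ?f, OF mono r0(1) pos q])
    fix r assume "r \<ge> r0"
    then have "r > 0" "?f (4 * r) > 0"
      using r0(1) pos mono[of r0 "4 * r"] by auto
    then show "?f r \<le> q * ?f (4 * r)"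
      unfolding q_def by (intro max_modulus_quadruple[OF D u bdry x0])
  qed
qed (auto intro!: filterlim_growth_exponent)

end
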